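(* Let $1\le \ell'\le \ell$ be integers, let $A_1,\dots,A_\ell,B_1,\dots,B_\ell$ be finite multisets of complex numbers and let $\alpha_1,\dots,\alpha_{\ell'},\beta_1,\dots,\beta_{\ell'}$ be complex numbers, all of these numbers having real part of absolute value at most $1/20$. Define $$\mathcal Q':=\sum_{\substack{\kappa_{\ell'+1},\dots,\kappa_\ell\ge0\\ M_1,\dots,M_\ell,N_1,\dots,N_\ell\ge 0,\ \min(M_j,N_j)=0\\ \sum_{j=1}^\ell M_j=\sum_{j=1}^\ell N_j}}\ \prod_{i=\ell'+1}^{\ell}A_i(M_i+\kappa_i)B_i(N_i+\kappa_i)X^{M_i+\kappa_i}\ \prod_{j=1}^{\ell'}\Sigma_{A_j,B_j,\alpha_j,\beta_j}(M_j,N_j)\,X^{M_j(1-\beta_j)-N_j\alpha_j}.$$ Then $$\mathcal Q'=\prod_{j=1}^{\ell'}\bigl(1-X^{1-\alpha_j-\beta_j}\bigr)\,\mathcal C\bigl(A_1\cup\dots\cup A_\ell\cup\{-\beta_1,\dots,-\beta_{\ell'}\},\;B_1\cup\dots\cup B_\ell\cup\{-\alpha_1,\dots,-\alpha_{\ell'}\}\bigr).$$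
   Context: Fix a real number $p>1$ (in the paper $p$ is a prime) and put $X=1/p$; for complex $z$, $X^z:=p^{-z}$. For a finite multiset $A$ of complex numbers and an integer $n$, define $A(n)=\sum\prod_{a\in A}X^{a j_a}$, the sum over all tuples $(j_a)_{a\in A}$ of nonnegative integers with $\sum_a j_a=n$ (so $A(n)=\tau_A(p^n)$ where $\prod_{a\in A}\zeta(s+a)=\sum_n\tau_A(n)n^{-s}$); in particular $A(n)=0$ for $n<0$ and $A(0)=1$. For complex $\alpha$, $A_\alpha:=\{a+\alpha:a\in A\}$. All unions are multiset unions. For multisets $A,B$ let $\mathcal C(A,B):=\sum_{M=0}^\infty A(M)B(M)X^M$. For finite multisets $A,B$, complex $\alpha,\beta$ and integers $M,N\ge0$ define $$\Sigma_{A,B,\alpha,\beta}(M,N)=\sum_{d,j,k\ge 0}\ \sum_{q\in\{0,1\}}(-1)^qX^{d(\alpha+\beta)}A_{-\alpha}\bigl(j+q+d-\min(q+d,N)\bigr)B_{-\beta}\bigl(k+q+d-\min(q+d,M)\bigr)X^{2q+d+j+k-\min(q+d,M)-\min(q+d,N)}.$$ The smallness of the real parts guarantees absolute convergence of all series involved. *)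

theory Defs
  imports "HOL-Analysis.Analysis"
begin

text \<open>\<open>Xpow p z\<close> is \<open>X\<^sup>z = p\<^sup>-\<^sup>z\<close>, where \<open>X = 1/p\<close>.\<close>

definition Xpow :: "real \<Rightarrow> complex \<Rightarrow> complex" where
  "Xpow p z = complex_of_real p powr (- z)"

text \<open>
  The occurrences \<open>(a, i)\<close> of the elements of a finite multiset: an element of multiplicity \<open>m\<close>
  contributes \<open>m\<close> of them. A tuple indexed by the multiset is a function on this set.
\<close>

definition occ :: "complex multiset \<Rightarrow> (complex \<times> nat) set" where
  "occ A = (SIGMA a:set_mset A. {..<count A a})"

definition tuples :: "complex multiset \<Rightarrow> int \<Rightarrow> (complex \<times> nat \<Rightarrow> nat) set" where
  "tuples A n = {f \<in> occ A \<rightarrow>\<^sub>E UNIV. (\<Sum>x\<in>occ A. int (f x)) = n}"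

definition mcoeff :: "real \<Rightarrow> complex multiset \<Rightarrow> int \<Rightarrow> complex" where
  "mcoeff p A n = (\<Sum>f\<in>tuples A n. \<Prod>x\<in>occ A. Xpow p (fst x * of_nat (f x)))"

lemma finite_occ: "finite (occ A)"
  by (simp add: occ_def)

lemma finite_tuples: "finite (tuples A n)"
proof (rule finite_subset)
  show "tuples A n \<subseteq> occ A \<rightarrow>\<^sub>E {..nat n}"
  proof
    fix f assume f: "f \<in> tuples A n"
    have "f x \<le> nat n" if "x \<in> occ A" for x
    proof -
      have "int (f x) \<le> (\<Sum>y\<in>occ A. int (f y))"
        by (rule member_le_sum[OF that _ finite_occ]) simp
      with f show ?thesis by (simp add: tuples_def)
    qed
    with f show "f \<in> occ A \<rightarrow>\<^sub>E {..nat n}"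
      by (auto simp: tuples_def PiE_iff)
  qed
  show "finite (occ A \<rightarrow>\<^sub>E {..nat n})"
    by (intro finite_PiE finite_occ) simp
qed

definition shift :: "complex multiset \<Rightarrow> complex \<Rightarrow> complex multiset" where
  "shift A \<alpha> = image_mset (\<lambda>a. a + \<alpha>) A"

definition C_term :: "real \<Rightarrow> complex multiset \<Rightarrow> complex multiset \<Rightarrow> nat \<Rightarrow> complex" where
  "C_term p A B M = mcoeff p A (int M) * mcoeff p B (int M) * Xpow p (of_nat M)"

definition C_series :: "real \<Rightarrow> complex multiset \<Rightarrow> complex multiset \<Rightarrow> complex" where
  "C_series p A B = (\<Sum>\<^sub>\<infinity>M. C_term p A B M)"

text \<open>
  The last exponent in \<open>Sigma_term\<close> may be negative when \<open>M\<close> and \<open>N\<close> are both positive, hence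
  the integer arithmetic.
\<close>

definition Sigma_term ::
  "real \<Rightarrow> complex multiset \<Rightarrow> complex multiset \<Rightarrow> complex \<Rightarrow> complex \<Rightarrow> nat \<Rightarrow> nat
    \<Rightarrow> nat \<times> nat \<times> nat \<times> nat \<Rightarrow> complex" where
  "Sigma_term p A B \<alpha> \<beta> M N = (\<lambda>(d, j, k, q).
     (- 1) ^ q * Xpow p (of_nat d * (\<alpha> + \<beta>))
     * mcoeff p (shift A (- \<alpha>)) (int j + int q + int d - min (int q + int d) (int N))
     * mcoeff p (shift B (- \<beta>)) (int k + int q + int d - min (int q + int d) (int M))
     * Xpow p (of_int (2 * int q + int d + int j + int k
                        - min (int q + int d) (int M) - min (int q + int d) (int N))))"

definition Sigma_index :: "(nat \<times> nat \<times> nat \<times> nat) set" where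
  "Sigma_index = UNIV \<times> UNIV \<times> UNIV \<times> {0, 1}"

definition Sigma_series ::
  "real \<Rightarrow> complex multiset \<Rightarrow> complex multiset \<Rightarrow> complex \<Rightarrow> complex \<Rightarrow> nat \<Rightarrow> nat \<Rightarrow> complex" where
  "Sigma_series p A B \<alpha> \<beta> M N = (\<Sum>\<^sub>\<infinity>x\<in>Sigma_index. Sigma_term p A B \<alpha> \<beta> M N x)"

text \<open>Here \<open>l'\<close> and \<open>l\<close> are the numbers of pairs \<open>(\<alpha>\<^sub>j, \<beta>\<^sub>j)\<close> and of pairs \<open>(A\<^sub>j, B\<^sub>j)\<close>.\<close>

definition Q_index ::
  "nat \<Rightarrow> nat \<Rightarrow> ((nat \<Rightarrow> nat) \<times> (nat \<Rightarrow> nat) \<times> (nat \<Rightarrow> nat)) set" where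
  "Q_index l' l = {(\<kappa>, M, N). \<kappa> \<in> {l'+1..l} \<rightarrow>\<^sub>E UNIV \<and> M \<in> {1..l} \<rightarrow>\<^sub>E UNIV \<and> N \<in> {1..l} \<rightarrow>\<^sub>E UNIV
     \<and> (\<forall>j\<in>{1..l}. min (M j) (N j) = 0) \<and> (\<Sum>j=1..l. M j) = (\<Sum>j=1..l. N j)}"

definition Q_term ::
  "real \<Rightarrow> nat \<Rightarrow> nat \<Rightarrow> (nat \<Rightarrow> complex multiset) \<Rightarrow> (nat \<Rightarrow> complex multiset)
    \<Rightarrow> (nat \<Rightarrow> complex) \<Rightarrow> (nat \<Rightarrow> complex)
    \<Rightarrow> (nat \<Rightarrow> nat) \<times> (nat \<Rightarrow> nat) \<times> (nat \<Rightarrow> nat) \<Rightarrow> complex" where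
  "Q_term p l' l A B \<alpha> \<beta> = (\<lambda>(\<kappa>, M, N).
     (\<Prod>i=l'+1..l. mcoeff p (A i) (int (M i + \<kappa> i)) * mcoeff p (B i) (int (N i + \<kappa> i))
                    * Xpow p (of_nat (M i + \<kappa> i)))
     * (\<Prod>j=1..l'. Sigma_series p (A j) (B j) (\<alpha> j) (\<beta> j) (M j) (N j)
                    * Xpow p (of_nat (M j) * (1 - \<beta> j) - of_nat (N j) * \<alpha> j)))"

definition Q_series ::
  "real \<Rightarrow> nat \<Rightarrow> nat \<Rightarrow> (nat \<Rightarrow> complex multiset) \<Rightarrow> (nat \<Rightarrow> complex multiset)
    \<Rightarrow> (nat \<Rightarrow> complex) \<Rightarrow> (nat \<Rightarrow> complex) \<Rightarrow> complex" where
  "Q_series p l' l A B \<alpha> \<beta> = (\<Sum>\<^sub>\<infinity>x\<in>Q_index l' l. Q_term p l' l A B \<alpha> \<beta> x)"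

definition augment ::
  "nat \<Rightarrow> nat \<Rightarrow> (nat \<Rightarrow> complex multiset) \<Rightarrow> (nat \<Rightarrow> complex) \<Rightarrow> complex multiset" where
  "augment l' l A \<beta> = (\<Sum>i=1..l. A i) + image_mset (\<lambda>j. - \<beta> j) (mset_set {1..l'})"

end

theory Submission
  imports Defs "HOL-Computational_Algebra.Formal_Power_Series"
begin

text \<open>
  Write \<open>u = X\<^sup>-\<^sup>\<alpha>\<close>, \<open>v = X\<^sup>-\<^sup>\<beta>\<close>, \<open>w = u v X\<close>. In the series \<open>\<Sigma>(M, N)\<close> take the arguments \<open>a\<close>, \<open>b\<close> of the two
  coefficients as summation variables instead of \<open>j\<close>, \<open>k\<close>. For fixed \<open>a\<close>, \<open>b\<close> the sum over \<open>(d, q)\<close> runs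
  over \<open>d + q \<le> min (a + N) (b + M)\<close> and telescopes, so that
  \<open>\<Sigma>(M, N) = \<Sum>\<^sub>a\<^sub>,\<^sub>b A(a) B(b) (u X)\<^sup>a (v X)\<^sup>b w\<^bsup>- min (a + N) (b + M)\<^esup>\<close>.
  Multiplied by \<open>X\<^sup>M v\<^sup>M u\<^sup>N / (1 - w)\<close> and with \<open>1 / (1 - w) = \<Sum>\<^sub>t w\<^sup>t\<close>, it becomes a sum over \<open>(a, b, r, r')\<close> with
  \<open>a + r + N = b + r' + M\<close>, where \<open>t = min r r'\<close>. When \<open>min M N = 0\<close> this is
  \<open>\<Sum>\<^sub>\<kappa> A'(M + \<kappa>) B'(N + \<kappa>) X\<^bsup>M + \<kappa>\<^esup>\<close> with \<open>A' = A \<union> {-\<beta>}\<close>, \<open>B' = B \<union> {-\<alpha>}\<close>, exactly the shape of the factors with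
  index above \<open>l'\<close>. Substituting \<open>R = M + \<kappa>\<close>, \<open>S = N + \<kappa>\<close> in all factors turns the whole series into the
  sum over all \<open>R\<close>, \<open>S\<close> with equal totals, which is the series on the right-hand side.
\<close>

subsection \<open>Coefficients as formal power series\<close>

text \<open>Induction on \<open>I\<close>: the new factor contributes a convolution, whose variable
  becomes the value of the tuple at the new index. Extensional functions are used so that the index
  set agrees with \<open>tuples\<close> and, later, with the index sets of the whole series.\<close>

lemma fps_prod_nth_PiE:
  fixes F :: "'a \<Rightarrow> 'b :: comm_ring_1 fps"
  assumes "finite I"
  shows "fps_nth (\<Prod>i\<in>I. F i) n
    = (\<Sum>f | f \<in> I \<rightarrow>\<^sub>E UNIV \<and> sum f I = n. \<Prod>i\<in>I. fps_nth (F i) (f i))"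
  using assms
proof (induction I arbitrary: n)
  case empty
  have "{f. f \<in> {} \<rightarrow>\<^sub>E (UNIV :: nat set) \<and> sum f {} = n} = (if n = 0 then {\<lambda>_. undefined} else {})"
    by auto
  then show ?case by simp
next
  case (insert a I)
  define S where "S m = {f. f \<in> I \<rightarrow>\<^sub>E (UNIV :: nat set) \<and> sum f I = m}" for m
  have fin: "finite (S m)" for m
  proof (rule finite_subset)
    show "S m \<subseteq> I \<rightarrow>\<^sub>E {..m}"
    proof
      fix f assume f: "f \<in> S m"
      then have "f i \<le> m" if "i \<in> I" for i
        using member_le_sum[OF that, of f] insert.hyps(1) by (simp add: S_def)
      with f show "f \<in> I \<rightarrow>\<^sub>E {..m}"
        by (simp add: S_def PiE_iff)
    qed
    show "finite (I \<rightarrow>\<^sub>E {..m})"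
      using insert.hyps(1) by (simp add: finite_PiE)
  qed
  have upd: "sum (f(a := j)) I = sum f I" "(\<Prod>i\<in>I. fps_nth (F i) ((f(a := j)) i)) = (\<Prod>i\<in>I. fps_nth (F i) (f i))"
    for f :: "'a \<Rightarrow> nat" and j
    using insert.hyps(2) by (auto intro!: sum.cong prod.cong)
  have "fps_nth (\<Prod>i\<in>insert a I. F i) n
      = (\<Sum>j=0..n. \<Sum>f\<in>S (n - j). fps_nth (F a) j * (\<Prod>i\<in>I. fps_nth (F i) (f i)))"
    using insert by (simp add: fps_mult_nth sum_distrib_left S_def)
  also have "\<dots> = (\<Sum>(j, f)\<in>(SIGMA j:{0..n}. S (n - j)). fps_nth (F a) j * (\<Prod>i\<in>I. fps_nth (F i) (f i)))"
    by (rule sum.Sigma) (use fin in auto)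
  also have "\<dots> = (\<Sum>f | f \<in> insert a I \<rightarrow>\<^sub>E UNIV \<and> sum f (insert a I) = n. \<Prod>i\<in>insert a I. fps_nth (F i) (f i))"
  \<comment> \<open>A tuple on \<open>insert a I\<close> is split into its value at \<open>a\<close>
    and its restriction to \<open>I\<close>; resetting \<open>a\<close> to \<open>undefined\<close>
    keeps the restriction extensional.\<close>
  proof (rule sum.reindex_bij_witness[where i = "\<lambda>f. (f a, f(a := undefined))" and j = "\<lambda>(j, f). f(a := j)"])
    fix jf assume "jf \<in> (SIGMA j:{0..n}. S (n - j))"
    then obtain j f where jf: "jf = (j, f)" "j \<le> n" "f \<in> I \<rightarrow>\<^sub>E UNIV" "sum f I = n - j"
      by (auto simp: S_def)
    show "(\<lambda>f. (f a, f(a := undefined))) ((\<lambda>(j, f). f(a := j)) jf) = jf"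
      using jf insert.hyps(2) by (auto simp: PiE_def extensional_def)
    show "(\<lambda>(j, f). f(a := j)) jf \<in> {f. f \<in> insert a I \<rightarrow>\<^sub>E UNIV \<and> sum f (insert a I) = n}"
      using jf insert.hyps upd by (auto simp: PiE_def extensional_def)
    show "(\<Prod>i\<in>insert a I. fps_nth (F i) (((\<lambda>(j, f). f(a := j)) jf) i))
        = (case jf of (j, f) \<Rightarrow> fps_nth (F a) j * (\<Prod>i\<in>I. fps_nth (F i) (f i)))"
      using jf insert.hyps upd(2)[of f j] by simp
  next
    fix f assume f: "f \<in> {f. f \<in> insert a I \<rightarrow>\<^sub>E (UNIV :: nat set) \<and> sum f (insert a I) = n}"
    show "(\<lambda>(j, f). f(a := j)) ((\<lambda>f. (f a, f(a := undefined))) f) = f"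
      by simp
    have "sum (f(a := undefined)) I = sum f I"
      using upd(1) .
    with f show "(f a, f(a := undefined)) \<in> (SIGMA j:{0..n}. S (n - j))"
      using insert.hyps by (auto simp: S_def PiE_def extensional_def)
  qed
  finally show ?case .
qed

section \<open>Summability over product index sets\<close>

lemma summable_on_geometric:
  fixes r :: real
  assumes "0 \<le> r" "r < 1"
  shows "(\<lambda>n. r ^ n) summable_on UNIV"
  using assms by (intro norm_summable_imp_summable_on) simp

lemma summable_on_Times_mult:
  fixes f :: "'a \<Rightarrow> real" and g :: "'b \<Rightarrow> real"
  assumes "f summable_on A" "g summable_on B" "\<And>x. x \<in> A \<Longrightarrow> f x \<ge> 0" "\<And>y. y \<in> B \<Longrightarrow> g y \<ge> 0"
  shows "(\<lambda>(x, y). f x * g y) summable_on A \<times> B"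
proof (rule summable_on_SigmaI)
  show "((\<lambda>y. case (x, y) of (x, y) \<Rightarrow> f x * g y) has_sum f x * infsum g B) B" for x
    using has_sum_cmult_right[OF has_sum_infsum[OF assms(2)]] by simp
  show "(\<lambda>x. f x * infsum g B) summable_on A"
    by (intro summable_on_cmult_left assms)
qed (use assms in auto)

lemma summable_on_PiE_geometric:
  fixes r :: real
  assumes "finite I" "0 \<le> r" "r < 1"
  shows "(\<lambda>f. \<Prod>i\<in>I. r ^ f i) summable_on I \<rightarrow>\<^sub>E UNIV"
proof -
  \<comment> \<open>The product rule used here is stated for the absolute summability of
    \<open>Infinite_Set_Sum\<close>; \<open>abs_summable_equivalent\<close> translates in both
    directions.\<close>
  have "Infinite_Set_Sum.abs_summable_on (\<lambda>f. \<Prod>i\<in>I. r ^ f i) (I \<rightarrow>\<^sub>E UNIV)"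
  proof (rule abs_summable_on_prod_PiE)
    show "Infinite_Set_Sum.abs_summable_on ((^) r) UNIV"
      using summable_on_geometric[OF assms(2,3)] assms(2)
      by (subst abs_summable_equivalent[symmetric]) (simp add: norm_power)
  qed (use assms in auto)
  then show ?thesis
    by (simp add: abs_summable_equivalent[symmetric] abs_summable_summable)
qed

section \<open>Powers of X and generating functions of the coefficients\<close>

lemma Xpow_add: "p > 1 \<Longrightarrow> Xpow p (y + z) = Xpow p y * Xpow p z"
  by (simp add: Xpow_def powr_def exp_add ring_distribs mult.commute flip: exp_add)

lemma Xpow_nonzero: "p > 1 \<Longrightarrow> Xpow p z \<noteq> 0"
  by (simp add: Xpow_def)

lemma Xpow_mult_nat: "p > 1 \<Longrightarrow> Xpow p (of_nat n * z) = Xpow p z ^ n"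
  by (induction n) (simp_all add: ring_distribs Xpow_add, simp add: Xpow_def)

lemma Xpow_minus: "p > 1 \<Longrightarrow> Xpow p (- z) = inverse (Xpow p z)"
  by (simp add: Xpow_def powr_minus)

lemma norm_Xpow: "p > 1 \<Longrightarrow> norm (Xpow p z) = p powr (- Re z)"
  by (simp add: Xpow_def norm_powr_real_powr)

text \<open>Each factor is \<open>1 / (1 - X^a T)\<close>, so this is the factor at p of the product
  of the \<zeta>(s + a), with T for p^(-s). Multiset unions become products.\<close>

definition gf :: "real \<Rightarrow> complex multiset \<Rightarrow> complex fps" where
  "gf p A = (\<Prod>a\<in>#A. Abs_fps (\<lambda>n. Xpow p a ^ n))"

lemma gf_plus: "gf p (A + B) = gf p A * gf p B"
  by (simp add: gf_def)

lemma mcoeff_gf: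
  assumes "p > 1"
  shows "mcoeff p A (int n) = fps_nth (gf p A) n"
proof -
  have "gf p A = (\<Prod>a\<in>set_mset A. \<Prod>i<count A a. Abs_fps (\<lambda>n. Xpow p a ^ n))"
    by (simp add: gf_def image_prod_mset_multiplicity)
  also have "\<dots> = (\<Prod>x\<in>occ A. Abs_fps (\<lambda>n. Xpow p (fst x) ^ n))"
    by (subst prod.Sigma) (auto simp: occ_def case_prod_unfold)
  finally have *: "gf p A = (\<Prod>x\<in>occ A. Abs_fps (\<lambda>n. Xpow p (fst x) ^ n))" .
  have "tuples A (int n) = {f. f \<in> occ A \<rightarrow>\<^sub>E UNIV \<and> sum f (occ A) = n}"
    by (auto simp: tuples_def simp flip: of_nat_sum)
  then show ?thesis
    unfolding * fps_prod_nth_PiE[OF finite_occ] mcoeff_def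
    using Xpow_mult_nat[OF assms] by (simp add: mult.commute)
qed

lemma gf_empty: "gf p {#} = 1"
  by (simp add: gf_def)

lemma gf_add_mset_nth:
  "fps_nth (gf p (add_mset a A)) n = (\<Sum>i\<le>n. Xpow p a ^ i * fps_nth (gf p A) (n - i))"
  by (simp add: gf_def fps_mult_nth atLeast0AtMost)

lemma gf_shift_nth:
  assumes "p > 1"
  shows "fps_nth (gf p (shift A c)) n = Xpow p c ^ n * fps_nth (gf p A) n"
proof (induction A arbitrary: n)
  case (add a A)
  have *: "shift (add_mset a A) c = add_mset (a + c) (shift A c)"
    by (simp add: shift_def)
  have "Xpow p (a + c) ^ i * (Xpow p c ^ (n - i) * y) = Xpow p c ^ n * (Xpow p a ^ i * y)"
    if "i \<le> n" for i y
    using that power_add[of "Xpow p c" i "n - i"]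
    by (simp add: Xpow_add[OF assms] power_mult_distrib mult_ac)
  then show ?case
    unfolding * gf_add_mset_nth add.IH sum_distrib_left by (intro sum.cong) auto
qed (simp add: shift_def gf_empty)

text \<open>Adding an element convolves with a geometric sequence of ratio at most \<open>r\<close>.
  Measured against \<open>R ^ n\<close> this is a partial sum of the geometric series in
  \<open>r / R\<close>, so only the constant grows. The gap between \<open>r\<close> and
  \<open>R\<close> absorbs the polynomial growth caused by repeated elements.\<close>

lemma gf_nth_bound:
  assumes "\<And>a. a \<in># A \<Longrightarrow> norm (Xpow p a) \<le> r" "0 < r" "r < R"
  shows "\<exists>C\<ge>0. \<forall>n. norm (fps_nth (gf p A) n) \<le> C * R ^ n"
  using assms(1)
proof (induction A)
  case empty
  then show ?case using assms by (intro exI[of _ 1]) (auto simp: gf_empty)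
next
  case (add a A)
  then obtain C where C: "C \<ge> 0" "\<And>n. norm (fps_nth (gf p A) n) \<le> C * R ^ n"
    by auto
  have R: "R > 0" using assms by simp
  have "norm (fps_nth (gf p (add_mset a A)) n) \<le> C / (1 - r / R) * R ^ n" for n
  proof -
    have "norm (fps_nth (gf p (add_mset a A)) n) \<le> (\<Sum>i\<le>n. r ^ i * (C * R ^ (n - i)))"
      unfolding gf_add_mset_nth
      by (intro sum_norm_le) (use add.prems C assms in \<open>auto simp: norm_mult norm_power intro!: mult_mono power_mono\<close>)
    also have "\<dots> = C * R ^ n * (\<Sum>i\<le>n. (r / R) ^ i)"
      using R by (auto simp: sum_distrib_left power_diff power_divide field_simps intro!: sum.cong)
    also have "(\<Sum>i\<le>n. (r / R) ^ i) \<le> (\<Sum>i. (r / R) ^ i)"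
      using assms R by (intro sum_le_suminf summable_geometric) auto
    also have "(\<Sum>i. (r / R) ^ i) = 1 / (1 - r / R)"
      using assms R by (intro suminf_geometric) auto
    finally show ?thesis using C R by (simp add: mult_left_mono)
  qed
  then show ?case using C assms R by (intro exI[of _ "C / (1 - r / R)"]) auto
qed

subsection \<open>A single factor\<close>

text \<open>The terms with \<open>q = 0\<close> run over d \<le> L and those with
  \<open>q = 1\<close> cancel all of them except d = L.\<close>

lemma window_sum:
  fixes y :: "'a :: comm_ring_1"
  shows "(\<Sum>(d, q) | q \<in> {0, 1} \<and> q + d \<le> L. (- 1) ^ q * y ^ d) = y ^ L"
proof -
  have *: "{(d, q). q \<in> {0, 1} \<and> q + d \<le> L} = (\<lambda>d. (d, 0)) ` {..L} \<union> (\<lambda>d. (d, 1 :: nat)) ` {..<L}"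
    by auto
  have "(\<Sum>(d, q) | q \<in> {0, 1} \<and> q + d \<le> L. (- 1) ^ q * y ^ d) = (\<Sum>d\<le>L. y ^ d) - (\<Sum>d<L. y ^ d)"
    unfolding * by (subst sum.union_disjoint) (auto simp: sum.reindex inj_on_def sum_negf)
  also have "\<dots> = y ^ L"
    by (simp flip: lessThan_Suc_atMost)
  finally show ?thesis .
qed

text \<open>\<open>s\<close> is the unit for all estimates: |X| is \<open>s ^ 20\<close>, and a
  parameter z with real part at most 1/20 in absolute value has |X^z| at most
  \<open>inverse s\<close>. Every bound then compares integer exponents of \<open>s\<close>.\<close>

locale small_base =
  fixes p s :: real
  assumes p_gt_1: "p > 1"
  defines "s \<equiv> p powr (- 1 / 20)"
begin

lemma s_pos: "0 < s" and s_less_1: "s < 1"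
  using p_gt_1 by (auto simp: s_def powr_less_one)

lemma s_power: "s ^ n = p powr (- real n / 20)"
  using p_gt_1 by (simp add: s_def powr_power)

lemma norm_Xpow_1: "norm (Xpow p 1) = s ^ 20"
  by (simp add: norm_Xpow p_gt_1 s_power)

lemma norm_Xpow_small: "\<bar>Re z\<bar> \<le> 1 / 20 \<Longrightarrow> norm (Xpow p z) \<le> inverse s"
  using p_gt_1 by (simp add: norm_Xpow s_def powr_minus[symmetric])

lemma norm_Xpow_mult_small: 
  assumes "\<bar>Re z\<bar> \<le> 1 / 20"
  shows "norm (Xpow p z * Xpow p 1) \<le> s ^ 19"
proof -
  have "norm (Xpow p z * Xpow p 1) \<le> inverse s * s ^ 20"
    unfolding norm_mult norm_Xpow_1 using norm_Xpow_small[OF assms] s_pos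
    by (intro mult_right_mono) auto
  also have "\<dots> = s ^ 19"
    using s_pos by (simp add: field_simps flip: power_Suc)
  finally show ?thesis .
qed

lemma coeff_bound:
  assumes "\<And>a. a \<in># A \<Longrightarrow> \<bar>Re a\<bar> \<le> 1 / 20"
  shows "\<exists>C\<ge>0. \<forall>n. norm (fps_nth (gf p A) n) * s ^ (2 * n) \<le> C"
proof -
  \<comment> \<open>The strict gap required by \<open>gf_nth_bound\<close>, with
    \<open>inverse s\<close> as \<open>r\<close> and its square as \<open>R\<close>.\<close>
  have "inverse s < inverse s ^ 2"
    using s_pos s_less_1 by (simp add: power2_eq_square field_simps)
  then obtain C where C: "C \<ge> 0" "\<And>n. norm (fps_nth (gf p A) n) \<le> C * (inverse s ^ 2) ^ n"
    using gf_nth_bound[of A p "inverse s" "inverse s ^ 2"] norm_Xpow_small assms s_pos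
    by auto
  have "norm (fps_nth (gf p A) n) * s ^ (2 * n) \<le> C" for n
  proof -
    have "norm (fps_nth (gf p A) n) * s ^ (2 * n) \<le> C * (inverse s ^ 2) ^ n * s ^ (2 * n)"
      using C s_pos by (intro mult_right_mono) auto
    also have "\<dots> = C"
      using s_pos by (simp add: power_inverse flip: power_mult)
    finally show ?thesis .
  qed
  with C(1) show ?thesis by blast
qed

end

locale local_factor = small_base +
  fixes A B :: "complex multiset" and \<alpha> \<beta> :: complex
  assumes A_small: "\<And>a. a \<in># A \<Longrightarrow> \<bar>Re a\<bar> \<le> 1 / 20"
    and B_small: "\<And>b. b \<in># B \<Longrightarrow> \<bar>Re b\<bar> \<le> 1 / 20"
    and \<alpha>_small: "\<bar>Re \<alpha>\<bar> \<le> 1 / 20"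
    and \<beta>_small: "\<bar>Re \<beta>\<bar> \<le> 1 / 20"
begin

abbreviation "u \<equiv> Xpow p (- \<alpha>)"
abbreviation "v \<equiv> Xpow p (- \<beta>)"
abbreviation "x \<equiv> Xpow p 1"
abbreviation "w \<equiv> Xpow p (1 - \<alpha> - \<beta>)"
abbreviation "f \<equiv> fps_nth (gf p A)"
abbreviation "g \<equiv> fps_nth (gf p B)"

lemma w_eq: "w = u * v * x"
  by (simp add: p_gt_1 algebra_simps flip: Xpow_add)

text \<open>The real part of 1 - \<alpha> - \<beta> lies between 18/20 and 22/20. The lower bound
  limits the growth of the powers of \<open>inverse w\<close> in \<Sigma>, the upper one makes the
  geometric series in \<open>w\<close> converge.\<close>

lemma norm_w: "s ^ 22 \<le> norm w" "norm w < 1"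
proof -
  show "s ^ 22 \<le> norm w"
    unfolding s_power norm_Xpow[OF p_gt_1] using p_gt_1 \<alpha>_small \<beta>_small by (intro powr_mono) auto
  show "norm w < 1"
    unfolding norm_Xpow[OF p_gt_1] using p_gt_1 \<alpha>_small \<beta>_small by (intro powr_less_one) auto
qed

lemma Sigma_term_eq:
  "Sigma_term p A B \<alpha> \<beta> M N (d, j, k, q)
    = (- 1) ^ q * inverse w ^ d * ((f (j + (q + d - N)) * (u * x) ^ (j + (q + d - N)))
        * (g (k + (q + d - M)) * (v * x) ^ (k + (q + d - M))))"
proof -
  define a b where "a = j + (q + d - N)" and "b = k + (q + d - M)"
  have a: "int j + int q + int d - min (int q + int d) (int N) = int a"
    and b: "int k + int q + int d - min (int q + int d) (int M) = int b"
    by (auto simp: a_def b_def)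
  \<comment> \<open>In terms of \<open>a\<close> and \<open>b\<close> both minima disappear from the
    exponent. The remaining X^(-d) combines with X^(d(\<alpha> + \<beta>)) to
    \<open>inverse w ^ d\<close>, while the shifts supply \<open>u ^ a\<close> and
    \<open>v ^ b\<close>.\<close>
  have e: "2 * int q + int d + int j + int k - min (int q + int d) (int M) - min (int q + int d) (int N)
      = int a + int b - int d"
    using a b by linarith
  have x: "Xpow p (of_int (int a + int b - int d)) = x ^ a * x ^ b * inverse x ^ d"
    using Xpow_mult_nat[OF p_gt_1, of a 1] Xpow_mult_nat[OF p_gt_1, of b 1]
      Xpow_mult_nat[OF p_gt_1, of d "- 1"]
      Xpow_add[OF p_gt_1, of "of_nat a + of_nat b" "- of_nat d"]
      Xpow_add[OF p_gt_1, of "of_nat a" "of_nat b"] Xpow_minus[OF p_gt_1, of 1]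
    by simp
  have uv: "Xpow p (of_nat d * (\<alpha> + \<beta>)) = inverse (u * v) ^ d"
    by (simp add: Xpow_mult_nat Xpow_add Xpow_minus p_gt_1)
  show ?thesis
    unfolding Sigma_term_def prod.case a b e x uv mcoeff_gf[OF p_gt_1] gf_shift_nth[OF p_gt_1]
      w_eq a_def[symmetric] b_def[symmetric]
    by (simp add: power_mult_distrib power_inverse mult_ac)
qed

lemma Sigma_abs_summable: "(\<lambda>y. norm (Sigma_term p A B \<alpha> \<beta> M N y)) summable_on Sigma_index"
proof -
  obtain C where C: "C \<ge> 0" "\<And>n. norm (f n) * s ^ (2 * n) \<le> C"
    using coeff_bound[of A] A_small by blast
  obtain D where D: "D \<ge> 0" "\<And>n. norm (g n) * s ^ (2 * n) \<le> D"
    using coeff_bound[of B] B_small by blast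
  \<comment> \<open>A coefficient costs \<open>s ^ 2\<close> per degree and its weight gains
    \<open>s ^ 19\<close>, which leaves \<open>s ^ 17\<close>.\<close>
  have weight: "norm (h n * (Xpow p z * x) ^ n) \<le> E * s ^ (17 * n)"
    if "\<And>n. norm (h n) * s ^ (2 * n) \<le> E" "\<bar>Re z\<bar> \<le> 1 / 20" for h :: "nat \<Rightarrow> complex" and E z n
  proof -
    have "norm (h n * (Xpow p z * x) ^ n) \<le> norm (h n) * (s ^ 19) ^ n"
      unfolding norm_mult[of "h n"] norm_power
      by (intro mult_left_mono power_mono norm_Xpow_mult_small that) auto
    also have "\<dots> = norm (h n) * s ^ (2 * n) * s ^ (17 * n)"
      by (simp flip: power_mult power_add)
    also have "\<dots> \<le> E * s ^ (17 * n)"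
      using that s_pos by (intro mult_right_mono) auto
    finally show ?thesis .
  qed
  have w0: "w \<noteq> 0"
    by (simp add: Xpow_nonzero p_gt_1)
  define K where "K = C * D / s ^ (17 * (M + N))"
  have K: "K \<ge> 0"
    using C D s_pos by (simp add: K_def)
  have bound: "norm (Sigma_term p A B \<alpha> \<beta> M N (d, j, k, q)) \<le> K * (s ^ d * (s ^ j * (s ^ k * 1)))"
    for d j k q
  proof -
    define a b where "a = j + (q + d - N)" and "b = k + (q + d - M)"
    have "norm (inverse w) \<le> inverse (s ^ 22)"
      using norm_w s_pos w0 by (simp add: norm_inverse le_imp_inverse_le)
    then have "norm (Sigma_term p A B \<alpha> \<beta> M N (d, j, k, q))
        \<le> inverse (s ^ 22) ^ d * ((C * s ^ (17 * a)) * (D * s ^ (17 * b)))"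
      unfolding Sigma_term_eq a_def[symmetric] b_def[symmetric]
        norm_mult[of "_ ^ q * _ ^ d"] norm_mult[of "_ ^ q"] norm_mult[of "f a * (u * x) ^ a"] norm_power[of "inverse w"]
      using C D s_pos weight[OF C(2), of "- \<alpha>"] weight[OF D(2), of "- \<beta>"] \<alpha>_small \<beta>_small
      by (intro mult_mono) (auto simp: norm_power intro!: power_mono mult_nonneg_nonneg)
    also have "\<dots> = inverse (s ^ 22) ^ d * K * s ^ (17 * (a + b + M + N))"
      using s_pos by (simp add: K_def ring_distribs power_add)
    \<comment> \<open>Since a + N \<ge> j + d and b + M \<ge> k + d, the exponent is at least 34 d +
      17 j + 17 k. Of this, 22 d pays for the powers of \<open>inverse w\<close> and one more power
      each of \<open>s ^ d\<close>, \<open>s ^ j\<close>, \<open>s ^ k\<close> gives convergence.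
      The constant \<open>K\<close> pays for adding M + N.\<close>
    also have "\<dots> \<le> inverse (s ^ 22) ^ d * K * s ^ (23 * d + j + k)"
      using s_pos s_less_1 K
      by (intro mult_left_mono power_decreasing) (auto simp: a_def b_def)
    also have "\<dots> = K * (s ^ d * (s ^ j * (s ^ k * 1)))"
    proof -
      have "s ^ (23 * d + j + k) = (s ^ 22) ^ d * (s ^ d * (s ^ j * s ^ k))"
        by (simp add: add.assoc flip: power_mult power_add)
      moreover have "inverse (s ^ 22) ^ d * (s ^ 22) ^ d = 1"
        using s_pos by (simp flip: power_mult_distrib)
      moreover have "y * K * (y1 * z) = K * z" if "y * y1 = 1" for y y1 z
        using that by (metis mult.assoc mult.commute mult_1)
      ultimately show ?thesis
        by simp
    qed
    finally show ?thesis .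
  qed
  have geo: "(\<lambda>n. s ^ n) summable_on UNIV"
    using s_pos s_less_1 by (intro summable_on_geometric) auto
  have "(\<lambda>(k, q :: nat). s ^ k * 1) summable_on UNIV \<times> {0, 1}"
    using geo s_pos by (intro summable_on_Times_mult) auto
  then have "(\<lambda>(j, k, q :: nat). s ^ j * (s ^ k * 1)) summable_on UNIV \<times> UNIV \<times> {0, 1}"
    using summable_on_Times_mult[OF geo, of "\<lambda>(k, q :: nat). s ^ k * 1"] s_pos
    by (auto simp: case_prod_unfold)
  then have "(\<lambda>(d, j, k, q :: nat). s ^ d * (s ^ j * (s ^ k * 1))) summable_on Sigma_index"
    using summable_on_Times_mult[OF geo, of "\<lambda>(j, k, q :: nat). s ^ j * (s ^ k * 1)"] s_pos
    by (auto simp: case_prod_unfold Sigma_index_def)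
  then have "(\<lambda>y. K * (case y of (d, j, k, q) \<Rightarrow> s ^ d * (s ^ j * (s ^ k * 1)))) summable_on Sigma_index"
    by (rule summable_on_cmult_right)
  then show ?thesis
    by (rule Infinite_Sum.abs_summable_on_comparison_test') (use bound in auto)
qed

lemma Sigma_has_sum:
  "((\<lambda>(a, b). inverse w ^ min (a + N) (b + M) * ((f a * (u * x) ^ a) * (g b * (v * x) ^ b)))
     has_sum Sigma_series p A B \<alpha> \<beta> M N) UNIV"
proof -
  define W where "W = (\<lambda>(a, b). {(d, q). q \<in> {0, 1 :: nat} \<and> q + d \<le> min (a + N) (b + M)})"
  define h where "h = (\<lambda>((a, b), (d, q)). (- 1) ^ q * inverse w ^ d * ((f a * (u * x) ^ a) * (g b * (v * x) ^ b)))"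
  have "(Sigma_term p A B \<alpha> \<beta> M N has_sum Sigma_series p A B \<alpha> \<beta> M N) Sigma_index"
    unfolding Sigma_series_def
    using abs_summable_summable[OF Sigma_abs_summable] by simp
  \<comment> \<open>For given a and b, the conditions j \<ge> 0 and k \<ge> 0 say that q + d is at
    most a + N and at most b + M; this is the window \<open>W\<close>.\<close>
  also have "?this \<longleftrightarrow> (h has_sum Sigma_series p A B \<alpha> \<beta> M N) (Sigma UNIV W)"
    by (rule has_sum_reindex_bij_witness[where
          j = "\<lambda>(d, j, k, q). ((j + (q + d - N), k + (q + d - M)), (d, q))" and
          i = "\<lambda>((a, b), (d, q)). (d, a - (q + d - N), b - (q + d - M), q)"])
      (auto simp: Sigma_index_def W_def h_def Sigma_term_eq)
  finally show ?thesis
  proof (rule has_sum_SigmaD)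
    fix ab :: "nat \<times> nat"
    obtain a b where ab: "ab = (a, b)" by fastforce
    have fin: "finite (W (a, b))"
      by (rule finite_subset[of _ "{..a + N} \<times> {0, 1}"]) (auto simp: W_def)
    have "(\<Sum>y\<in>W (a, b). h ((a, b), y))
        = (\<Sum>(d, q)\<in>W (a, b). (- 1) ^ q * inverse w ^ d) * ((f a * (u * x) ^ a) * (g b * (v * x) ^ b))"
      unfolding sum_distrib_right h_def by (intro sum.cong) auto
    also have "(\<Sum>(d, q)\<in>W (a, b). (- 1) ^ q * inverse w ^ d) = inverse w ^ min (a + N) (b + M)"
      unfolding W_def prod.case by (rule window_sum)
    finally show "((\<lambda>y. h (ab, y)) has_sum
        (case ab of (a, b) \<Rightarrow> inverse w ^ min (a + N) (b + M) * ((f a * (u * x) ^ a) * (g b * (v * x) ^ b)))) (W ab)"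
      using fin by (simp add: ab has_sum_finite_iff)
  qed
qed

text \<open>
  The truncated subtractions are the positive and negative parts of \<open>(b + M) - (a + N)\<close>; at most one
  of them is nonzero.
\<close>

definition diag :: "nat \<Rightarrow> nat \<Rightarrow> nat \<times> nat \<Rightarrow> complex" where
  "diag M N = (\<lambda>(a, b). f a * g b * v ^ (b + M - (a + N)) * u ^ (a + N - (b + M))
     * x ^ (a + (b + M - (a + N))))"

lemma diag_has_sum:
  "(diag M N has_sum Sigma_series p A B \<alpha> \<beta> M N * Xpow p (of_nat M * (1 - \<beta>) - of_nat N * \<alpha>)) UNIV"
proof -
  have "Xpow p (of_nat M * (1 - \<beta>) - of_nat N * \<alpha>) = Xpow p (of_nat M * (1 - \<beta>) + of_nat N * (- \<alpha>))"
    by simp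
  also have "\<dots> = Xpow p (1 - \<beta>) ^ M * u ^ N"
    by (simp only: Xpow_add[OF p_gt_1] Xpow_mult_nat[OF p_gt_1])
  also have "Xpow p (1 - \<beta>) = x * v"
    using Xpow_add[OF p_gt_1, of 1 "- \<beta>"] by simp
  also have "(x * v) ^ M * u ^ N = x ^ M * v ^ M * u ^ N"
    by (simp add: power_mult_distrib)
  finally have c: "Xpow p (of_nat M * (1 - \<beta>) - of_nat N * \<alpha>) = x ^ M * v ^ M * u ^ N" .
  have nz: "u \<noteq> 0" "v \<noteq> 0" "x \<noteq> 0" "w \<noteq> 0"
    by (simp_all add: Xpow_nonzero p_gt_1)
  have regroup: "y * (f a * y1 * (g b * y2)) * y3 = f a * g b * (y * (y2 * y3 * y1))" for y y1 y2 y3 a b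
    by (simp only: mult_ac)
  \<comment> \<open>The powers collected are \<open>u ^ (a + N)\<close>, \<open>v ^ (b + M)\<close>
    and \<open>x ^ (a + b + M)\<close>. Dividing by the power of w = u v x with the smaller of a + N
    and b + M leaves only the surplus \<open>e\<close>: of \<open>v\<close> and \<open>x\<close> in
    the first case, of \<open>u\<close> in the second.\<close>
  have "inverse w ^ min (a + N) (b + M) * ((f a * (u * x) ^ a) * (g b * (v * x) ^ b)) * (x ^ M * v ^ M * u ^ N)
      = diag M N (a, b)" for a b
  proof (cases "a + N \<le> b + M")
    case True
    then obtain e where e: "b + M = a + N + e"
      using le_Suc_ex by blast
    have "(v * x) ^ b * (x ^ M * v ^ M * u ^ N) * (u * x) ^ a = x ^ a * x ^ (b + M) * v ^ (b + M) * u ^ (a + N)"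
      by (simp add: power_mult_distrib power_add)
    also have "\<dots> = w ^ (a + N) * (v ^ e * x ^ (a + e))"
      unfolding e w_eq by (simp add: power_mult_distrib power_add)
    finally have "inverse w ^ (a + N) * ((v * x) ^ b * (x ^ M * v ^ M * u ^ N) * (u * x) ^ a) = v ^ e * x ^ (a + e)"
      using nz(4) by (simp add: power_inverse)
    moreover have "min (a + N) (b + M) = (a + N)"
      using e by simp
    moreover have "diag M N (a, b) = f a * g b * (v ^ e * x ^ (a + e))"
      by (simp add: diag_def e mult_ac)
    ultimately show ?thesis
      unfolding regroup by simp
  next
    case False
    then obtain e where e: "a + N = b + M + e"
      using nat_le_linear le_Suc_ex by blast
    have "(v * x) ^ b * (x ^ M * v ^ M * u ^ N) * (u * x) ^ a = x ^ a * x ^ (b + M) * v ^ (b + M) * u ^ (a + N)"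
      by (simp add: power_mult_distrib power_add)
    also have "\<dots> = w ^ (b + M) * (u ^ e * x ^ a)"
      unfolding e w_eq by (simp add: power_mult_distrib power_add)
    finally have "inverse w ^ (b + M) * ((v * x) ^ b * (x ^ M * v ^ M * u ^ N) * (u * x) ^ a) = u ^ e * x ^ a"
      using nz(4) by (simp add: power_inverse)
    moreover have "min (a + N) (b + M) = (b + M)"
      using e by simp
    moreover have "diag M N (a, b) = f a * g b * (u ^ e * x ^ a)"
      by (simp add: diag_def e mult_ac)
    ultimately show ?thesis
      unfolding regroup by simp
  qed
  then have *: "(case y of (a, b) \<Rightarrow> inverse w ^ min (a + N) (b + M) * ((f a * (u * x) ^ a) * (g b * (v * x) ^ b)))
      * (x ^ M * v ^ M * u ^ N) = diag M N y" for y
    by (cases y) simp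
  show ?thesis
    using has_sum_cmult_left[OF Sigma_has_sum[of N M], of "x ^ M * v ^ M * u ^ N"]
    unfolding * c .
qed

text \<open>Quadruples with a + r + N = b + r' + M have a + r = M + \<kappa> and b + r' = N +
  \<kappa> for an integer \<kappa> \<ge> -min(M, N). The hypothesis therefore makes \<kappa> range
  over the natural numbers, and the sum over the quadruples with given \<kappa> is a product of two
  convolutions.\<close>

lemma local_factor_has_sum:
  assumes "min M N = 0"
  shows "((\<lambda>\<kappa>. fps_nth (gf p (add_mset (- \<beta>) A)) (M + \<kappa>) * fps_nth (gf p (add_mset (- \<alpha>) B)) (N + \<kappa>)
             * x ^ (M + \<kappa>))
    has_sum Sigma_series p A B \<alpha> \<beta> M N * Xpow p (of_nat M * (1 - \<beta>) - of_nat N * \<alpha>) / (1 - w)) UNIV"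
proof -
  define S where "S = Sigma_series p A B \<alpha> \<beta> M N * Xpow p (of_nat M * (1 - \<beta>) - of_nat N * \<alpha>)"
  have diag: "(diag M N has_sum S) UNIV"
    unfolding S_def by (rule diag_has_sum)
  have geo: "((\<lambda>t. w ^ t) has_sum 1 / (1 - w)) UNIV"
    by (rule norm_summable_imp_has_sum) (use norm_w geometric_sums[of w] in \<open>auto simp: norm_power\<close>)
  define h where "h = (\<lambda>(\<kappa>, (r, r')). v ^ r * f (M + \<kappa> - r) * (u ^ r' * g (N + \<kappa> - r')) * x ^ (M + \<kappa>))"
  have double: "((\<lambda>(y, t). diag M N y * w ^ t) has_sum S / (1 - w)) (UNIV \<times> UNIV)"
  proof (rule has_sum_SigmaI)
    show "((\<lambda>t. case (y, t) of (y, t) \<Rightarrow> diag M N y * w ^ t) has_sum diag M N y * (1 / (1 - w))) UNIV" for y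
      using has_sum_cmult_right[OF geo] by simp
    show "((\<lambda>y. diag M N y * (1 / (1 - w))) has_sum S / (1 - w)) UNIV"
      using has_sum_cmult_left[OF diag, of "1 / (1 - w)"] by simp
    have "(\<lambda>(y, t). norm (diag M N y) * norm (w ^ t)) summable_on UNIV \<times> UNIV"
      using diag geo by (intro summable_on_Times_mult)
        (auto dest!: has_sum_imp_summable simp: summable_on_iff_abs_summable_on_complex)
    then show "(\<lambda>(y, t). diag M N y * w ^ t) summable_on UNIV \<times> UNIV"
      by (auto simp: summable_on_iff_abs_summable_on_complex norm_mult case_prod_unfold)
  qed
  \<comment> \<open>The difference r - r' is forced by \<open>a\<close> and \<open>b\<close>, so
    \<open>t\<close> only has to record the minimum of r and r'. The first component is \<kappa> = a
    + r - M.\<close>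
  define J where "J = (\<lambda>((a, b), t). (a + (t + (b + M - (a + N))) - M, (t + (b + M - (a + N)), t + (a + N - (b + M)))))"
  define I where "I = (\<lambda>(\<kappa>, (r, r')). ((M + \<kappa> - r, N + \<kappa> - r'), min r r'))"
  have sum_eq: "((\<lambda>(y, t). diag M N y * w ^ t) has_sum S / (1 - w)) (UNIV \<times> UNIV)
      \<longleftrightarrow> (h has_sum S / (1 - w)) (SIGMA \<kappa>:UNIV. {..M + \<kappa>} \<times> {..N + \<kappa>})"
  proof (rule has_sum_reindex_bij_witness[where j = J and i = I])
    fix y :: "(nat \<times> nat) \<times> nat"
    obtain a b t where y: "y = ((a, b), t)" by (metis surj_pair)
    define r r' where "r = t + (b + M - (a + N))" and "r' = t + (a + N - (b + M))"
    have \<kappa>: "M + (a + r - M) = a + r" "N + (a + r - M) = b + r'" "min r r' = t"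
      using assms by (auto simp: r_def r'_def min_def split: if_splits)
    have J: "J y = (a + r - M, (r, r'))"
      by (simp add: J_def y r_def r'_def)
    show "I (J y) = y" "J y \<in> (SIGMA \<kappa>:UNIV. {..M + \<kappa>} \<times> {..N + \<kappa>})"
      unfolding J using \<kappa> by (simp_all add: I_def y)
    have "v ^ r * u ^ r' * x ^ r = w ^ t * (v ^ (b + M - (a + N)) * u ^ (a + N - (b + M)) * x ^ (b + M - (a + N)))"
      by (simp add: r_def r'_def w_eq power_add power_mult_distrib)
    then have "diag M N (a, b) * w ^ t = f a * g b * (v ^ r * u ^ r' * x ^ r) * x ^ a"
      by (simp only: diag_def prod.case power_add mult_ac)
    moreover have "h (J y) = f a * g b * (v ^ r * u ^ r' * x ^ r) * x ^ a"
      unfolding J h_def prod.case \<kappa> by (simp add: power_add)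
    ultimately show "h (J y) = (case y of (y, t) \<Rightarrow> diag M N y * w ^ t)"
      by (simp add: y)
  next
    fix y :: "nat \<times> nat \<times> nat" assume "y \<in> (SIGMA \<kappa>:UNIV. {..M + \<kappa>} \<times> {..N + \<kappa>})"
    then show "J (I y) = y"
      using assms by (auto simp: I_def J_def min_def)
  qed auto
  have "(h has_sum S / (1 - w)) (SIGMA \<kappa>:UNIV. {..M + \<kappa>} \<times> {..N + \<kappa>})"
    using double sum_eq by blast
  then have "((\<lambda>\<kappa>. fps_nth (gf p (add_mset (- \<beta>) A)) (M + \<kappa>) * fps_nth (gf p (add_mset (- \<alpha>) B)) (N + \<kappa>)
             * x ^ (M + \<kappa>)) has_sum S / (1 - w)) UNIV"
  proof (rule has_sum_SigmaD)
    fix \<kappa>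
    show "((\<lambda>y. h (\<kappa>, y)) has_sum fps_nth (gf p (add_mset (- \<beta>) A)) (M + \<kappa>) * fps_nth (gf p (add_mset (- \<alpha>) B)) (N + \<kappa>)
             * x ^ (M + \<kappa>)) ({..M + \<kappa>} \<times> {..N + \<kappa>})"
      unfolding gf_add_mset_nth sum_product sum.cartesian_product h_def
      by (intro has_sum_finiteI) (auto simp: sum_distrib_right case_prod_unfold)
  qed
  then show ?thesis
    unfolding S_def .
qed

end

subsection \<open>The product of all factors\<close>

lemma gf_sum: "gf p (\<Sum>i\<in>I. A i) = (\<Prod>i\<in>I. gf p (A i))"
  by (induction I rule: infinite_finite_induct) (simp_all add: gf_plus gf_empty)

lemma prod_split_at:
  fixes l l' :: nat
  assumes "l' \<le> l"
  shows "prod h {1..l} = prod h {1..l'} * prod h {l'+1..l}"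
proof -
  have "{1..l} = {1..l'} \<union> {l'+1..l}"
    using assms by auto
  then show ?thesis
    by (simp add: prod.union_disjoint)
qed

locale euler_factors = small_base +
  fixes l l' :: nat and A B :: "nat \<Rightarrow> complex multiset" and \<alpha> \<beta> :: "nat \<Rightarrow> complex"
  assumes l'_le: "l' \<le> l"
    and A_small: "\<And>i a. i \<in> {1..l} \<Longrightarrow> a \<in># A i \<Longrightarrow> \<bar>Re a\<bar> \<le> 1 / 20"
    and B_small: "\<And>i b. i \<in> {1..l} \<Longrightarrow> b \<in># B i \<Longrightarrow> \<bar>Re b\<bar> \<le> 1 / 20"
    and \<alpha>_small: "\<And>j. j \<in> {1..l'} \<Longrightarrow> \<bar>Re (\<alpha> j)\<bar> \<le> 1 / 20"
    and \<beta>_small: "\<And>j. j \<in> {1..l'} \<Longrightarrow> \<bar>Re (\<beta> j)\<bar> \<le> 1 / 20"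
begin

lemma local_factor:
  assumes "j \<in> {1..l'}"
  shows "local_factor p (A j) (B j) (\<alpha> j) (\<beta> j)"
proof -
  have "j \<in> {1..l}"
    using assms l'_le by simp
  then show ?thesis
    using assms by unfold_locales (fact p_gt_1 | blast intro: A_small B_small \<alpha>_small \<beta>_small)+
qed

text \<open>The additional elements of \<open>augment\<close> are distributed one to each index up
  to \<open>l'\<close>, so that its generating function is a product over the indices 1 to
  \<open>l\<close>.\<close>

definition extend :: "(nat \<Rightarrow> complex multiset) \<Rightarrow> (nat \<Rightarrow> complex) \<Rightarrow> nat \<Rightarrow> complex multiset" where
  "extend E \<gamma> i = (if i \<le> l' then add_mset (- \<gamma> i) (E i) else E i)"

lemma gf_augment: "gf p (augment l' l E \<gamma>) = (\<Prod>i=1..l. gf p (extend E \<gamma> i))"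
proof -
  have "gf p (image_mset (\<lambda>j. - \<gamma> j) (mset_set {1..l'})) = (\<Prod>j=1..l'. gf p {#- \<gamma> j#})"
    by (simp add: gf_def prod_unfold_prod_mset image_mset.compositionality o_def)
  then have "gf p (augment l' l E \<gamma>) = (\<Prod>j=1..l'. gf p (E j) * gf p {#- \<gamma> j#}) * (\<Prod>i=l'+1..l. gf p (E i))"
    unfolding augment_def gf_plus gf_sum prod_split_at[OF l'_le]
    by (simp add: prod.distrib mult_ac)
  also have "(\<Prod>j=1..l'. gf p (E j) * gf p {#- \<gamma> j#}) = (\<Prod>i=1..l'. gf p (extend E \<gamma> i))"
    by (intro prod.cong) (auto simp: extend_def simp flip: gf_plus)
  also have "(\<Prod>i=l'+1..l. gf p (E i)) = (\<Prod>i=l'+1..l. gf p (extend E \<gamma> i))"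
    by (intro prod.cong) (auto simp: extend_def)
  finally show ?thesis
    unfolding prod_split_at[OF l'_le] .
qed

abbreviation "f i \<equiv> fps_nth (gf p (extend A \<beta> i))"
abbreviation "g i \<equiv> fps_nth (gf p (extend B \<alpha> i))"

definition balanced :: "((nat \<Rightarrow> nat) \<times> (nat \<Rightarrow> nat)) set" where
  "balanced = {(R, S). R \<in> {1..l} \<rightarrow>\<^sub>E UNIV \<and> S \<in> {1..l} \<rightarrow>\<^sub>E UNIV \<and> sum R {1..l} = sum S {1..l}}"

definition expanded :: "(nat \<Rightarrow> nat) \<times> (nat \<Rightarrow> nat) \<Rightarrow> complex" where
  "expanded = (\<lambda>(R, S). \<Prod>i=1..l. f i (R i) * g i (S i) * Xpow p 1 ^ R i)"

section \<open>Absolute convergence and expansion of the right-hand side\<close>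

lemma coeff_bounds:
  assumes "\<And>i a. i \<in> {1..l} \<Longrightarrow> a \<in># E i \<Longrightarrow> \<bar>Re a\<bar> \<le> 1 / 20"
    and "\<And>j. j \<in> {1..l'} \<Longrightarrow> \<bar>Re (\<gamma> j)\<bar> \<le> 1 / 20"
  shows "\<exists>C. \<forall>i\<in>{1..l}. C i \<ge> 0 \<and> (\<forall>n. norm (fps_nth (gf p (extend E \<gamma> i)) n) * s ^ (2 * n) \<le> C i)"
proof (rule bchoice, rule ballI)
  fix i assume "i \<in> {1..l}"
  then have "\<bar>Re a\<bar> \<le> 1 / 20" if "a \<in># extend E \<gamma> i" for a
    using that assms(1)[of i a] assms(2)[of i] by (cases "i \<le> l'"; cases "a = - \<gamma> i") (simp_all add: extend_def)
  then show "\<exists>C\<ge>0. \<forall>n. norm (fps_nth (gf p (extend E \<gamma> i)) n) * s ^ (2 * n) \<le> C"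
    by (rule coeff_bound)
qed

text \<open>On \<^const>\<open>balanced\<close>, the weight \<open>X\<close> can be distributed evenly over \<open>R\<close> and \<open>S\<close>.\<close>

lemma expanded_abs_summable: "(\<lambda>y. norm (expanded y)) summable_on balanced"
proof -
  obtain C where C: "\<And>i. i \<in> {1..l} \<Longrightarrow> C i \<ge> 0"
      "\<And>i n. i \<in> {1..l} \<Longrightarrow> norm (f i n) * s ^ (2 * n) \<le> C i"
    using coeff_bounds[of A \<beta>] A_small \<beta>_small by blast
  obtain D where D: "\<And>i. i \<in> {1..l} \<Longrightarrow> D i \<ge> 0"
      "\<And>i n. i \<in> {1..l} \<Longrightarrow> norm (g i n) * s ^ (2 * n) \<le> D i"
    using coeff_bounds[of B \<alpha>] B_small \<alpha>_small by blast
  \<comment> \<open>Half of the exponent 20 of |X| goes to each of \<open>R\<close> and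
    \<open>S\<close>. The coefficient bound uses 2 of the 10, and one of the remaining 8 suffices
    for convergence.\<close>
  have weight: "y * s ^ (10 * n) \<le> E * s ^ n" if "y * s ^ (2 * n) \<le> E" "E \<ge> 0" for y E n
  proof -
    have "y * s ^ (10 * n) = y * s ^ (2 * n) * s ^ (8 * n)"
      by (simp flip: power_add)
    also have "\<dots> \<le> E * s ^ (8 * n)"
      using that s_pos by (intro mult_right_mono) auto
    also have "\<dots> \<le> E * s ^ n"
      using that s_pos s_less_1 by (intro mult_left_mono power_decreasing) auto
    finally show ?thesis .
  qed
  define K where "K = prod C {1..l} * prod D {1..l}"
  have bound: "norm (expanded y) \<le> K * (case y of (R, S) \<Rightarrow> (\<Prod>i=1..l. s ^ R i) * (\<Prod>i=1..l. s ^ S i))"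
    if "y \<in> balanced" for y
  proof -
    obtain R S where y: "y = (R, S)" by fastforce
    with that have RS: "sum R {1..l} = sum S {1..l}"
      by (simp add: balanced_def)
    have "(\<Prod>i=1..l. norm (Xpow p 1 ^ R i)) = s ^ (20 * sum R {1..l})"
      by (simp add: norm_power norm_Xpow_1 power_sum sum_distrib_left flip: power_mult)
    also have "20 * sum R {1..l} = 10 * sum R {1..l} + 10 * sum S {1..l}"
      using RS by simp
    also have "s ^ \<dots> = (\<Prod>i=1..l. s ^ (10 * R i)) * (\<Prod>i=1..l. s ^ (10 * S i))"
      by (simp only: power_add sum_distrib_left power_sum)
    finally have "norm (expanded y)
        = (\<Prod>i=1..l. norm (f i (R i)) * s ^ (10 * R i)) * (\<Prod>i=1..l. norm (g i (S i)) * s ^ (10 * S i))"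
      by (simp add: expanded_def y norm_mult prod.distrib flip: prod_norm)
    also have "\<dots> \<le> (\<Prod>i=1..l. C i * s ^ R i) * (\<Prod>i=1..l. D i * s ^ S i)"
    proof (rule mult_mono)
      show "(\<Prod>i=1..l. norm (f i (R i)) * s ^ (10 * R i)) \<le> (\<Prod>i=1..l. C i * s ^ R i)"
        using C s_pos weight by (intro prod_mono) simp
      show "(\<Prod>i=1..l. norm (g i (S i)) * s ^ (10 * S i)) \<le> (\<Prod>i=1..l. D i * s ^ S i)"
        using D s_pos weight by (intro prod_mono) simp
    qed (use C s_pos in \<open>auto intro!: prod_nonneg mult_nonneg_nonneg\<close>)
    finally show ?thesis
      by (simp add: y K_def prod.distrib mult_ac)
  qed
  have "(\<lambda>(R, S). (\<Prod>i=1..l. s ^ R i) * (\<Prod>i=1..l. s ^ S i))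
      summable_on ({1..l} \<rightarrow>\<^sub>E UNIV) \<times> ({1..l} \<rightarrow>\<^sub>E UNIV)"
    using s_pos s_less_1
    by (intro summable_on_Times_mult summable_on_PiE_geometric) (auto intro: prod_nonneg)
  then have "(\<lambda>(R, S). (\<Prod>i=1..l. s ^ R i) * (\<Prod>i=1..l. s ^ S i)) summable_on balanced"
    by (rule summable_on_subset_banach) (auto simp: balanced_def)
  then have "(\<lambda>y. K * (case y of (R, S) \<Rightarrow> (\<Prod>i=1..l. s ^ R i) * (\<Prod>i=1..l. s ^ S i))) summable_on balanced"
    by (rule summable_on_cmult_right)
  then show ?thesis
    by (rule Infinite_Sum.abs_summable_on_comparison_test') (use bound in auto)
qed

lemma finite_sum_eq: "finite {R. R \<in> {1..l} \<rightarrow>\<^sub>E UNIV \<and> sum R {1..l} = (n :: nat)}"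
proof (rule finite_subset)
  show "{R. R \<in> {1..l} \<rightarrow>\<^sub>E UNIV \<and> sum R {1..l} = n} \<subseteq> {1..l} \<rightarrow>\<^sub>E {..n}"
  proof
    fix R assume R: "R \<in> {R. R \<in> {1..l} \<rightarrow>\<^sub>E UNIV \<and> sum R {1..l} = n}"
    then have "R i \<le> n" if "i \<in> {1..l}" for i
      using member_le_sum[OF that, of R] by simp
    with R show "R \<in> {1..l} \<rightarrow>\<^sub>E {..n}"
      by (simp add: PiE_iff)
  qed
  show "finite ({1..l} \<rightarrow>\<^sub>E {..n})"
    by (simp add: finite_PiE)
qed

lemma C_term_expanded:
  "C_term p (augment l' l A \<beta>) (augment l' l B \<alpha>) n
    = (\<Sum>y\<in>{R. R \<in> {1..l} \<rightarrow>\<^sub>E UNIV \<and> sum R {1..l} = n} \<times> {S. S \<in> {1..l} \<rightarrow>\<^sub>E UNIV \<and> sum S {1..l} = n}. expanded y)"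
proof -
  have "C_term p (augment l' l A \<beta>) (augment l' l B \<alpha>) n
    = (\<Sum>(R, S)\<in>{R. R \<in> {1..l} \<rightarrow>\<^sub>E UNIV \<and> sum R {1..l} = n} \<times> {S. S \<in> {1..l} \<rightarrow>\<^sub>E UNIV \<and> sum S {1..l} = n}.
        (\<Prod>i=1..l. f i (R i)) * (\<Prod>i=1..l. g i (S i)) * Xpow p 1 ^ n)"
    unfolding C_term_def mcoeff_gf[OF p_gt_1] gf_augment fps_prod_nth_PiE[OF finite_atLeastAtMost]
      sum_product sum.cartesian_product
    using Xpow_mult_nat[OF p_gt_1, of n 1] by (simp add: sum_distrib_right case_prod_unfold)
  also have "\<dots> = (\<Sum>y\<in>{R. R \<in> {1..l} \<rightarrow>\<^sub>E UNIV \<and> sum R {1..l} = n} \<times> {S. S \<in> {1..l} \<rightarrow>\<^sub>E UNIV \<and> sum S {1..l} = n}. expanded y)"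
    by (intro sum.cong) (auto simp: expanded_def prod.distrib simp flip: power_sum)
  finally show ?thesis .
qed

lemma C_summable: "(\<lambda>n. norm (C_term p (augment l' l A \<beta>) (augment l' l B \<alpha>) n)) summable_on UNIV"
  and expanded_has_sum: "(expanded has_sum C_series p (augment l' l A \<beta>) (augment l' l B \<alpha>)) balanced"
proof -
  define T where "T n = {R. R \<in> {1..l} \<rightarrow>\<^sub>E UNIV \<and> sum R {1..l} = (n :: nat)}" for n
  have fin: "finite (T n)" for n
    unfolding T_def by (rule finite_sum_eq)
  have expanded: "(expanded has_sum infsum expanded balanced) balanced"
    using abs_summable_summable[OF expanded_abs_summable] by simp
  \<comment> \<open>Recording the common total \<open>n\<close> splits \<open>balanced\<close> into
    the finite fibres \<open>T n \<times> T n\<close>, whose sums are the terms of the right-hand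
    series.\<close>
  also have "?this \<longleftrightarrow> ((\<lambda>(n, y). expanded y) has_sum infsum expanded balanced) (SIGMA n:UNIV. T n \<times> T n)"
    by (rule has_sum_reindex_bij_witness[where j = "\<lambda>(R, S). (sum R {1..l}, (R, S))" and i = snd])
      (auto simp: balanced_def T_def)
  finally have C: "(C_term p (augment l' l A \<beta>) (augment l' l B \<alpha>) has_sum infsum expanded balanced) UNIV"
    by (rule has_sum_SigmaD) (use fin in \<open>auto simp: has_sum_finite_iff C_term_expanded T_def\<close>)
  then show "(\<lambda>n. norm (C_term p (augment l' l A \<beta>) (augment l' l B \<alpha>) n)) summable_on UNIV"
    unfolding summable_on_iff_abs_summable_on_complex[symmetric] by (rule has_sum_imp_summable)
  show "(expanded has_sum C_series p (augment l' l A \<beta>) (augment l' l B \<alpha>)) balanced"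
    unfolding C_series_def infsumI[OF C] by (rule expanded)
qed

section \<open>Comparison with the series Q'\<close>

abbreviation "w j \<equiv> Xpow p (1 - \<alpha> j - \<beta> j)"

text \<open>\<kappa> belongs to the index of Q' and covers the indices above \<open>l'\<close>;
  \<kappa>' collects the variables that \<open>local_factor_has_sum\<close> introduces for the
  others. They stay separate because \<kappa>' is summed out first.\<close>

definition split_term :: "((nat \<Rightarrow> nat) \<times> (nat \<Rightarrow> nat) \<times> (nat \<Rightarrow> nat)) \<times> (nat \<Rightarrow> nat) \<Rightarrow> complex" where
  "split_term = (\<lambda>((\<kappa>, M, N), \<kappa>').
     (\<Prod>j=1..l'. f j (M j + \<kappa>' j) * g j (N j + \<kappa>' j) * Xpow p 1 ^ (M j + \<kappa>' j)) *
     (\<Prod>i=l'+1..l. f i (M i + \<kappa> i) * g i (N i + \<kappa> i) * Xpow p 1 ^ (M i + \<kappa> i)))"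

text \<open>The sum over \<kappa>' factors into one-variable sums, evaluated by
  \<open>local_factor_has_sum\<close>; their denominators form the product on the right.\<close>

lemma split_term_infsum:
  assumes "y \<in> Q_index l' l"
  shows "infsum (\<lambda>\<kappa>'. split_term (y, \<kappa>')) ({1..l'} \<rightarrow>\<^sub>E UNIV)
    = Q_term p l' l A B \<alpha> \<beta> y / (\<Prod>j=1..l'. 1 - w j)"
proof -
  obtain \<kappa> M N where y: "y = (\<kappa>, M, N)" by (metis surj_pair)
  have MN: "min (M j) (N j) = 0" if "j \<in> {1..l'}" for j
    using assms that l'_le by (auto simp: y Q_index_def)
  define h where "h j k = f j (M j + k) * g j (N j + k) * Xpow p 1 ^ (M j + k)" for j k
  have h: "(h j has_sum Sigma_series p (A j) (B j) (\<alpha> j) (\<beta> j) (M j) (N j)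
      * Xpow p (of_nat (M j) * (1 - \<beta> j) - of_nat (N j) * \<alpha> j) / (1 - w j)) UNIV" if "j \<in> {1..l'}" for j
    using local_factor.local_factor_has_sum[OF local_factor[OF that] MN[OF that]] that
    by (simp add: h_def[abs_def] extend_def)
  have "infsum (\<lambda>\<kappa>'. split_term (y, \<kappa>')) ({1..l'} \<rightarrow>\<^sub>E UNIV)
      = infsum (\<lambda>\<kappa>'. \<Prod>j=1..l'. h j (\<kappa>' j)) ({1..l'} \<rightarrow>\<^sub>E UNIV)
        * (\<Prod>i=l'+1..l. f i (M i + \<kappa> i) * g i (N i + \<kappa> i) * Xpow p 1 ^ (M i + \<kappa> i))"
    by (simp add: y split_term_def infsum_cmult_left' h_def)
  also have "infsum (\<lambda>\<kappa>'. \<Prod>j=1..l'. h j (\<kappa>' j)) ({1..l'} \<rightarrow>\<^sub>E UNIV) = (\<Prod>j=1..l'. infsum (h j) UNIV)"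
    by (intro infsum_prod_PiE_abs finite_atLeastAtMost,
        unfold summable_on_iff_abs_summable_on_complex[symmetric])
      (rule has_sum_imp_summable[OF h])
  also have "\<dots> = (\<Prod>j=1..l'. Sigma_series p (A j) (B j) (\<alpha> j) (\<beta> j) (M j) (N j)
      * Xpow p (of_nat (M j) * (1 - \<beta> j) - of_nat (N j) * \<alpha> j) / (1 - w j))"
    using h infsumI by (intro prod.cong) blast+
  also have "(\<Prod>i=l'+1..l. f i (M i + \<kappa> i) * g i (N i + \<kappa> i) * Xpow p 1 ^ (M i + \<kappa> i))
      = (\<Prod>i=l'+1..l. mcoeff p (A i) (int (M i + \<kappa> i)) * mcoeff p (B i) (int (N i + \<kappa> i))
                    * Xpow p (of_nat (M i + \<kappa> i)))"
    using Xpow_mult_nat[OF p_gt_1, of _ 1]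
    by (intro prod.cong) (auto simp: extend_def mcoeff_gf[OF p_gt_1] simp del: of_nat_add)
  finally show ?thesis
    by (simp add: y Q_term_def prod_dividef)
qed

definition combine ::
  "((nat \<Rightarrow> nat) \<times> (nat \<Rightarrow> nat) \<times> (nat \<Rightarrow> nat)) \<times> (nat \<Rightarrow> nat) \<Rightarrow> (nat \<Rightarrow> nat) \<times> (nat \<Rightarrow> nat)" where
  "combine = (\<lambda>((\<kappa>, M, N), \<kappa>'). (\<lambda>i\<in>{1..l}. M i + (if i \<le> l' then \<kappa>' i else \<kappa> i),
                               \<lambda>i\<in>{1..l}. N i + (if i \<le> l' then \<kappa>' i else \<kappa> i)))"

text \<open>The inverse splits \<open>(R, S)\<close> into its common part \<open>min R S\<close> and the two excesses.\<close>

lemma bij_betw_combine: "bij_betw combine (Q_index l' l \<times> ({1..l'} \<rightarrow>\<^sub>E UNIV)) balanced"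
proof -
  define I :: "(nat \<Rightarrow> nat) \<times> (nat \<Rightarrow> nat) \<Rightarrow> ((nat \<Rightarrow> nat) \<times> (nat \<Rightarrow> nat) \<times> (nat \<Rightarrow> nat)) \<times> (nat \<Rightarrow> nat)"
    where "I = (\<lambda>(R, S). ((\<lambda>i\<in>{l'+1..l}. min (R i) (S i), \<lambda>i\<in>{1..l}. R i - S i, \<lambda>i\<in>{1..l}. S i - R i),
                  \<lambda>i\<in>{1..l'}. min (R i) (S i)))"
  show ?thesis
  proof (rule bij_betw_byWitness[where f' = I])
    show "\<forall>y\<in>Q_index l' l \<times> ({1..l'} \<rightarrow>\<^sub>E UNIV). I (combine y) = y"
    proof
      fix y assume y: "y \<in> Q_index l' l \<times> ({1..l'} \<rightarrow>\<^sub>E (UNIV :: nat set))"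
      obtain \<kappa> M N \<kappa>' where y': "y = ((\<kappa>, M, N), \<kappa>')" by (metis surj_pair)
      have min: "min (M i + k) (N i + k) = k" "M i + k - (N i + k) = M i" "N i + k - (M i + k) = N i"
        if "i \<in> {1..l}" for i k
      proof -
        have "min (M i) (N i) = 0"
          using y that by (simp add: y' Q_index_def)
        then have "M i = 0 \<or> N i = 0"
          by linarith
        then show "min (M i + k) (N i + k) = k" "M i + k - (N i + k) = M i" "N i + k - (M i + k) = N i"
          by auto
      qed
      show "I (combine y) = y"
        using y l'_le min
        by (auto simp: y' I_def combine_def Q_index_def fun_eq_iff restrict_def PiE_def extensional_def)
    qed
    show "\<forall>y\<in>balanced. combine (I y) = y"
      using l'_le by (auto simp: combine_def I_def balanced_def fun_eq_iff restrict_def PiE_def extensional_def)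
    show "combine ` (Q_index l' l \<times> ({1..l'} \<rightarrow>\<^sub>E UNIV)) \<subseteq> balanced"
      by (auto simp: combine_def balanced_def Q_index_def sum.distrib)
    show "I ` balanced \<subseteq> Q_index l' l \<times> ({1..l'} \<rightarrow>\<^sub>E UNIV)"
    proof -
      have "(\<Sum>i=1..l. R i - S i) = (\<Sum>i=1..l. S i - R i)" if "sum R {1..l} = sum S {1..l}" for R S :: "nat \<Rightarrow> nat"
      proof -
        \<comment> \<open>Both sides are the sum of the maxima of \<open>R i\<close> and
          \<open>S i\<close>, because the subtraction is truncated.\<close>
        have "(\<Sum>i=1..l. R i - S i) + sum S {1..l} = (\<Sum>i=1..l. S i - R i) + sum R {1..l}"
          unfolding sum.distrib[symmetric] by (intro sum.cong) auto
        with that show ?thesis by simp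
      qed
      then show ?thesis
        by (auto simp: I_def balanced_def Q_index_def)
    qed
  qed
qed

lemma split_term_eq:
  "split_term y = expanded (combine y)"
proof -
  obtain \<kappa> M N \<kappa>' where y: "y = ((\<kappa>, M, N), \<kappa>')" by (metis surj_pair)
  show ?thesis
    unfolding y split_term_def expanded_def combine_def prod.case prod_split_at[OF l'_le]
    using l'_le by (intro arg_cong2[of _ _ _ _ "(*)"] prod.cong) auto
qed

lemma split_term_abs_summable:
  "(\<lambda>y. norm (split_term y)) summable_on Q_index l' l \<times> ({1..l'} \<rightarrow>\<^sub>E UNIV)"
  unfolding split_term_eq
  by (rule iffD2[OF summable_on_reindex_bij_betw[OF bij_betw_combine, of "\<lambda>y. norm (expanded y)"] expanded_abs_summable])

lemma one_minus_w_nonzero: "(\<Prod>j=1..l'. 1 - w j) \<noteq> 0"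
  using local_factor.norm_w(2)[OF local_factor] by fastforce

text \<open>Up to the constant \<open>W\<close>, a term of Q' is an inner sum of
  \<open>split_term\<close>. Absolute summability over the product index set thus suffices, and no
  estimate of \<Sigma>(M, N) uniform in M and N has to be made.\<close>

lemma Q_abs_summable: "(\<lambda>y. norm (Q_term p l' l A B \<alpha> \<beta> y)) summable_on Q_index l' l"
proof -
  define W where "W = (\<Prod>j=1..l'. 1 - w j)"
  have sum: "(\<lambda>\<kappa>'. norm (split_term (y, \<kappa>'))) summable_on ({1..l'} \<rightarrow>\<^sub>E UNIV)" if "y \<in> Q_index l' l" for y
    using split_term_abs_summable that unfolding Infinite_Sum.abs_summable_on_Sigma_iff by blast
  have "(\<lambda>y. \<Sum>\<^sub>\<infinity>\<kappa>'\<in>{1..l'} \<rightarrow>\<^sub>E UNIV. norm (split_term (y, \<kappa>'))) summable_on Q_index l' l"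
    using split_term_abs_summable unfolding Infinite_Sum.abs_summable_on_Sigma_iff
    by (auto intro: abs_summable_summable)
  then have "(\<lambda>y. norm W * (\<Sum>\<^sub>\<infinity>\<kappa>'\<in>{1..l'} \<rightarrow>\<^sub>E UNIV. norm (split_term (y, \<kappa>')))) summable_on Q_index l' l"
    by (rule summable_on_cmult_right)
  then show ?thesis
  proof (rule Infinite_Sum.abs_summable_on_comparison_test')
    fix y assume y: "y \<in> Q_index l' l"
    have "Q_term p l' l A B \<alpha> \<beta> y = W * infsum (\<lambda>\<kappa>'. split_term (y, \<kappa>')) ({1..l'} \<rightarrow>\<^sub>E UNIV)"
      using one_minus_w_nonzero unfolding split_term_infsum[OF y] W_def[symmetric] by simp
    then show "norm (Q_term p l' l A B \<alpha> \<beta> y) \<le> norm W * (\<Sum>\<^sub>\<infinity>\<kappa>'\<in>{1..l'} \<rightarrow>\<^sub>E UNIV. norm (split_term (y, \<kappa>')))"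
      using norm_infsum_bound[OF sum[OF y]] by (simp add: norm_mult mult_left_mono)
  qed
qed

text \<open>The sum of \<open>split_term\<close> is computed in two ways: \<open>combine\<close>
  turns it into the right-hand series, and summing over \<kappa>' first gives Q' divided by the
  product of the \<open>1 - w j\<close>.\<close>

lemma Q_series_eq:
  "Q_series p l' l A B \<alpha> \<beta>
    = (\<Prod>j=1..l'. 1 - w j) * C_series p (augment l' l A \<beta>) (augment l' l B \<alpha>)"
proof -
  define C where "C = C_series p (augment l' l A \<beta>) (augment l' l B \<alpha>)"
  have "(split_term has_sum C) (Q_index l' l \<times> ({1..l'} \<rightarrow>\<^sub>E UNIV))"
    unfolding split_term_eq[abs_def] C_def
    by (rule iffD2[OF has_sum_reindex_bij_betw[OF bij_betw_combine, of expanded] expanded_has_sum])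
  then have "((\<lambda>y. Q_term p l' l A B \<alpha> \<beta> y / (\<Prod>j=1..l'. 1 - w j)) has_sum C) (Q_index l' l)"
  proof (rule has_sum_SigmaD)
    fix y assume y: "y \<in> Q_index l' l"
    have "(\<lambda>\<kappa>'. norm (split_term (y, \<kappa>'))) summable_on ({1..l'} \<rightarrow>\<^sub>E UNIV)"
      using split_term_abs_summable y unfolding Infinite_Sum.abs_summable_on_Sigma_iff by blast
    then show "((\<lambda>\<kappa>'. split_term (y, \<kappa>')) has_sum Q_term p l' l A B \<alpha> \<beta> y / (\<Prod>j=1..l'. 1 - w j))
        ({1..l'} \<rightarrow>\<^sub>E UNIV)"
      unfolding split_term_infsum[OF y, symmetric] by (rule has_sum_infsum[OF abs_summable_summable])
  qed
  from has_sum_cmult_right[OF this, of "\<Prod>j=1..l'. 1 - w j"]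
  have "(Q_term p l' l A B \<alpha> \<beta> has_sum (\<Prod>j=1..l'. 1 - w j) * C) (Q_index l' l)"
    by (simp only: times_divide_eq_right nonzero_mult_div_cancel_left[OF one_minus_w_nonzero])
  then show ?thesis
    unfolding Q_series_def C_def by (rule infsumI)
qed

end

theorem theorem4:
  fixes p :: real and l l' :: nat
    and A B :: "nat \<Rightarrow> complex multiset" and \<alpha> \<beta> :: "nat \<Rightarrow> complex"
  assumes "p > 1"
    and "1 \<le> l'" and "l' \<le> l"
    and "\<And>i a. i \<in> {1..l} \<Longrightarrow> a \<in># A i \<Longrightarrow> \<bar>Re a\<bar> \<le> 1 / 20"
    and "\<And>i b. i \<in> {1..l} \<Longrightarrow> b \<in># B i \<Longrightarrow> \<bar>Re b\<bar> \<le> 1 / 20"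
    and "\<And>j. j \<in> {1..l'} \<Longrightarrow> \<bar>Re (\<alpha> j)\<bar> \<le> 1 / 20"
    and "\<And>j. j \<in> {1..l'} \<Longrightarrow> \<bar>Re (\<beta> j)\<bar> \<le> 1 / 20"
  shows "(\<forall>j\<in>{1..l'}. \<forall>M N.
        (\<lambda>x. norm (Sigma_term p (A j) (B j) (\<alpha> j) (\<beta> j) M N x)) summable_on Sigma_index)
    \<and> (\<lambda>x. norm (Q_term p l' l A B \<alpha> \<beta> x)) summable_on Q_index l' l
    \<and> (\<lambda>M. norm (C_term p (augment l' l A \<beta>) (augment l' l B \<alpha>) M)) summable_on UNIV
    \<and> Q_series p l' l A B \<alpha> \<beta>
        = (\<Prod>j=1..l'. 1 - Xpow p (1 - \<alpha> j - \<beta> j))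
          * C_series p (augment l' l A \<beta>) (augment l' l B \<alpha>)"
proof -
  interpret euler_factors p "p powr (- 1 / 20)" l l' A B \<alpha> \<beta>
    by unfold_locales (fact assms)+
  show ?thesis
    using local_factor.Sigma_abs_summable[OF local_factor] Q_abs_summable C_summable Q_series_eq
    by blast
qed

end
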